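(* Let $H$ be a separable Hilbert space, $C$ a closed non-empty subset of $H$, $(Q^k)_{k\in\mathbb{N}}$ a random sequence of $\mathbb{S}(H)$, and $(u^k)_{k\in\mathbb{N}}$ a random sequence of $H$. Suppose that: (i) $(Q^k)_{k\in\mathbb{N}}$ takes values in $\mathbb{S}_\alpha(H)$ for a given $\alpha>0$ and is uniformly almost surely quasi-decreasing; (ii) $(u^k)_{k\in\mathbb{N}}$ is stable with respect to the target $C$ relative to $(Q^k)_{k\in\mathbb{N}}$; (iii) every weak sequential cluster point of $(u^k)_{k\in\mathbb{N}}$ is almost surely in $C$, meaning that there exists a measurable subset $\Omega_{(iii)}$ of $\Omega$ of probability one such that for all $\omega\in\Omega_{(iii)}$, every weak sequential cluster point of $(u^k(\omega))_{k\in\mathbb{N}}$ is in $C$. Then $(u^k)_{k\in\mathbb{N}}$ converges almost surely weakly to a random variable in $C$.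
   Context: Hilbert spaces are real. All random variables are defined on a probability space $(\Omega,\sigma(\Omega),\mathbb{P})$. $\mathbb{S}(H)$ is the set of bounded self-adjoint linear operators from $H$ to $H$. For $M\in\mathbb{S}(H)$ and $u\in H$, $\|u\|_M^2=\langle Mu,u\rangle$. For $M,N\in\mathbb{S}(H)$, $N\preccurlyeq M$ means $\|u\|_N\le\|u\|_M$ for all $u\in H$ (i.e. $\langle Nu,u\rangle\le\langle Mu,u\rangle$). $\mathbb{S}_\alpha(H)$ is the set of $M\in\mathbb{S}(H)$ such that $\alpha\,\mathrm{Id}\preccurlyeq M$. A random sequence $(M^k)_{k\in\mathbb{N}}$ in $\mathbb{S}(H)$ is uniformly almost surely quasi-decreasing if there exists a deterministic non-negative sequence $(\eta^k)_{k\in\mathbb{N}}$ such that $\sum_k\eta^k<\infty$ and, almost surely, $M^{k+1}\preccurlyeq(1+\eta^k)M^k$ for all $k\in\mathbb{N}$. A random sequence $(u^k)_{k\in\mathbb{N}}$ with values in $H$ is stable with respect to the target $C$ relative to $(Q^k)_{k\in\mathbb{N}}$ if for all $u\in C$, the sequence $(\|u^k-u\|_{Q^k})_{k\in\mathbb{N}}$ converges almost surely. *)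

theory Defs
  imports "HOL-Probability.Probability"
begin

definition selfadjoint_ops :: "('h::real_inner \<Rightarrow>\<^sub>L 'h) set"
  where "selfadjoint_ops = {T. \<forall>x y. inner (blinfun_apply T x) y = inner x (blinfun_apply T y)}"

definition op_norm :: "('h::real_inner \<Rightarrow>\<^sub>L 'h) \<Rightarrow> 'h \<Rightarrow> real"
  where "op_norm T x = sqrt (inner (blinfun_apply T x) x)"

definition loewner_le :: "('h::real_inner \<Rightarrow>\<^sub>L 'h) \<Rightarrow> ('h \<Rightarrow>\<^sub>L 'h) \<Rightarrow> bool"
  where "loewner_le S T \<longleftrightarrow> (\<forall>x. inner (blinfun_apply S x) x \<le> inner (blinfun_apply T x) x)"

definition selfadjoint_ops_ge :: "real \<Rightarrow> ('h::real_inner \<Rightarrow>\<^sub>L 'h) set"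
  where "selfadjoint_ops_ge \<alpha> = {T \<in> selfadjoint_ops. loewner_le (\<alpha> *\<^sub>R id_blinfun) T}"

text \<open>Measurability of random operators is taken in the strong sense. For a Borel measurable map
  into the operators with the norm topology, which is not separable in general, it is automatic
  (see the lemma below), so the strong sense is the more permissive convention.\<close>

definition random_operator :: "'a measure \<Rightarrow> ('a \<Rightarrow> ('h::real_inner \<Rightarrow>\<^sub>L 'h)) \<Rightarrow> bool"
  where "random_operator P T \<longleftrightarrow>
    (\<forall>\<omega>\<in>space P. T \<omega> \<in> selfadjoint_ops) \<and>
    (\<forall>x. (\<lambda>\<omega>. blinfun_apply (T \<omega>) x) \<in> borel_measurable P)"

lemma random_operator_borel:
  assumes "T \<in> borel_measurable P" and "\<And>\<omega>. \<omega> \<in> space P \<Longrightarrow> T \<omega> \<in> selfadjoint_ops"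
  shows "random_operator P T"
proof -
  have "(\<lambda>\<omega>. blinfun_apply (T \<omega>) x) \<in> borel_measurable P" for x
  proof (rule borel_measurable_continuous_on[OF _ assms(1)])
    show "continuous_on UNIV (\<lambda>S. blinfun_apply S x)"
      by (intro continuous_intros)
  qed
  then show ?thesis
    using assms(2) by (simp add: random_operator_def)
qed

definition quasi_decreasing :: "'a measure \<Rightarrow> (nat \<Rightarrow> 'a \<Rightarrow> ('h::real_inner \<Rightarrow>\<^sub>L 'h)) \<Rightarrow> bool"
  where "quasi_decreasing P T \<longleftrightarrow>
    (\<exists>\<eta>::nat \<Rightarrow> real. (\<forall>k. 0 \<le> \<eta> k) \<and> summable \<eta> \<and>
      (AE \<omega> in P. \<forall>k. loewner_le (T (Suc k) \<omega>) ((1 + \<eta> k) *\<^sub>R T k \<omega>)))"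

definition stable_wrt ::
    "'a measure \<Rightarrow> 'h::real_inner set \<Rightarrow> (nat \<Rightarrow> 'a \<Rightarrow> ('h \<Rightarrow>\<^sub>L 'h)) \<Rightarrow> (nat \<Rightarrow> 'a \<Rightarrow> 'h) \<Rightarrow> bool"
  where "stable_wrt P C Q u \<longleftrightarrow>
    (\<forall>z\<in>C. AE \<omega> in P. convergent (\<lambda>k. op_norm (Q k \<omega>) (u k \<omega> - z)))"

definition weakly_converges :: "(nat \<Rightarrow> 'h::real_inner) \<Rightarrow> 'h \<Rightarrow> bool"
  where "weakly_converges s x \<longleftrightarrow> (\<forall>y. (\<lambda>n. inner (s n) y) \<longlonglongrightarrow> inner x y)"

definition weak_seq_cluster_point :: "(nat \<Rightarrow> 'h::real_inner) \<Rightarrow> 'h \<Rightarrow> bool"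
  where "weak_seq_cluster_point s x \<longleftrightarrow>
    (\<exists>r::nat \<Rightarrow> nat. strict_mono r \<and> weakly_converges (s \<circ> r) x)"

end

theory Submission
  imports Defs "HOL-Complex_Analysis.Great_Picard"
begin

text \<open>
  Opial's argument is run for each \<open>\<omega>\<close> outside a single null set. Stability is required along a
  countable dense subset \<open>D\<close> of \<open>C\<close> only, so its null sets can be collected. Dividing
  \<open>Q\<^sup>k\<close> by \<open>(1 + \<eta>\<^sup>0) \<cdots> (1 + \<eta>\<^sup>k\<^sup>-\<^sup>1)\<close> makes the sequence decreasing,
  hence \<open>Q\<^sup>k\<close> converges strongly and is bounded. Expanding squares shows that
  \<open>\<langle>Q\<^sup>k u\<^sup>k, z - z\<^sub>0\<rangle>\<close> converges for \<open>z, z\<^sub>0 \<in> D\<close>; this expression is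
  linear in \<open>z - z\<^sub>0\<close> with a uniform bound, so convergence passes to \<open>z \<in> C\<close>. For two weak
  cluster points \<open>x, y \<in> C\<close> and \<open>w = lim Q\<^sup>k (x - y)\<close>, the limit of
  \<open>\<langle>u\<^sup>k, Q\<^sup>k (x - y)\<rangle>\<close> equals both \<open>\<langle>x, w\<rangle>\<close> and \<open>\<langle>y, w\<rangle>\<close>,
  and coercivity forces \<open>x = y\<close>.
\<close>

section \<open>Weak convergence in Hilbert spaces\<close>

text \<open>The representing vector minimises \<open>\<parallel>y\<parallel>\<^sup>2 - 2 f y\<close>. The sort
  \<open>{real_inner, polish_space}\<close> is not below class \<open>banach\<close>, so completeness enters through
  \<open>complete_space\<close>.\<close>

lemma riesz_representation:
  fixes f :: "'h::{real_inner, complete_space} \<Rightarrow> real"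
  assumes "bounded_linear f"
  obtains x where "\<And>y. f y = inner x y"
proof -
  interpret f: bounded_linear f by fact
  define J where "J y = (norm y)\<^sup>2 - 2 * f y" for y
  obtain K where K: "norm (f y) \<le> norm y * K" for y
    using f.bounded by blast
  have J_ge: "- K\<^sup>2 \<le> J y" for y
  proof -
    have "0 \<le> (norm y - K)\<^sup>2" by simp
    then have "2 * (norm y * K) \<le> (norm y)\<^sup>2 + K\<^sup>2"
      by (simp add: power2_diff)
    then show ?thesis
      using K[of y] by (simp add: J_def abs_le_iff)
  qed
  define m where "m = Inf (range J)"
  have bdd: "bdd_below (range J)"
    using J_ge by (intro bdd_belowI[of _ "- K\<^sup>2"]) auto
  have m_le: "m \<le> J y" for y
    unfolding m_def by (rule cInf_lower[OF _ bdd]) simp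
  have "\<exists>y. J y < m + 1 / Suc n" for n
    using cInf_lessD[of "range J" "m + 1 / Suc n"] by (auto simp: m_def)
  then obtain s where s: "J (s n) < m + 1 / Suc n" for n by metis
  \<comment> \<open>The linear part of \<open>J\<close> cancels at the midpoint, so this is the
    parallelogram law. As \<open>J\<close> is at least \<open>m\<close> at the midpoint, minimising
    sequences are Cauchy.\<close>
  have parallelogram: "(norm (a - b))\<^sup>2 = 2 * J a + 2 * J b - 4 * J ((1/2) *\<^sub>R (a + b))" for a b
  proof -
    have "(norm ((1/2) *\<^sub>R (a + b)))\<^sup>2 = (norm (a + b))\<^sup>2 / 4"
      by (simp add: power_divide)
    then show ?thesis
      by (simp add: J_def f.scaleR f.add power2_norm_eq_inner inner_diff inner_add inner_commute
          field_simps)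
  qed
  have "Cauchy s"
  proof (rule metric_CauchyI)
    fix e :: real assume "0 < e"
    then obtain N where N: "4 / (e\<^sup>2) < real N"
      using reals_Archimedean2 by blast
    have "dist (s i) (s j) < e" if "N \<le> i" "N \<le> j" for i j
    proof -
      have *: "1 / real (Suc k) \<le> 1 / real (Suc N)" if "N \<le> k" for k
        using that by (simp add: frac_le)
      have "(norm (s i - s j))\<^sup>2 \<le> 2 / Suc i + 2 / Suc j"
        using s[of i] s[of j] m_le[of "(1/2) *\<^sub>R (s i + s j)"] unfolding parallelogram by linarith
      also have "\<dots> \<le> 4 / Suc N"
        using *[OF that(1)] *[OF that(2)] by linarith
      also have "\<dots> < e\<^sup>2"
      proof -
        have "4 < real N * e\<^sup>2" using N \<open>0 < e\<close> by (simp add: field_simps)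
        also have "\<dots> \<le> real (Suc N) * e\<^sup>2" by (simp add: mult_right_mono)
        finally show ?thesis by (simp add: field_simps)
      qed
      finally show ?thesis
        using \<open>0 < e\<close> by (simp add: dist_norm power2_less_imp_less)
    qed
    then show "\<exists>N. \<forall>i\<ge>N. \<forall>j\<ge>N. dist (s i) (s j) < e" by blast
  qed
  then obtain x where x: "s \<longlonglongrightarrow> x"
    using Cauchy_convergent convergent_def by blast
  have Jx: "J x = m"
  proof (rule antisym[OF _ m_le])
    have "(\<lambda>n. J (s n)) \<longlonglongrightarrow> J x"
      unfolding J_def by (intro tendsto_intros f.tendsto x)
    moreover have "(\<lambda>n. m + 1 / Suc n) \<longlonglongrightarrow> m + 0"
      by (intro tendsto_intros LIMSEQ_Suc[OF lim_1_over_n])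
    ultimately show "J x \<le> m"
      using s by (intro LIMSEQ_le) (auto intro!: exI[of _ 0] less_imp_le)
  qed
  have "f y = inner x y" for y
  proof (rule ccontr)
    assume neq: "f y \<noteq> inner x y"
    define d where "d = f y - inner x y"
    \<comment> \<open>Minimality of \<open>x\<close> along the line through \<open>x\<close> in
      direction \<open>y\<close>: the right-hand side is
      \<open>J (x + t *\<^sub>R y) - J x\<close>.\<close>
    have pos: "0 \<le> 2 * t * (- d) + t\<^sup>2 * (norm y)\<^sup>2" for t
    proof -
      have "J x \<le> J (x + t *\<^sub>R y)" using m_le Jx by simp
      then show ?thesis
        unfolding J_def d_def power2_norm_eq_inner
        by (simp add: f.scaleR f.add inner_add inner_commute power2_eq_square algebra_simps)
    qed
    have "y \<noteq> 0" using neq by auto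
    \<comment> \<open>The choice \<open>t = d / (norm y)\<^sup>2\<close> minimises the quadratic in
      \<open>pos\<close>; its value there is negative unless \<open>d = 0\<close>.\<close>
    then have "2 * (d / (norm y)\<^sup>2) * (- d) + (d / (norm y)\<^sup>2)\<^sup>2 * (norm y)\<^sup>2 = - (d\<^sup>2 / (norm y)\<^sup>2)"
      by (simp add: field_simps power2_eq_square)
    moreover have "0 < d\<^sup>2 / (norm y)\<^sup>2" using neq \<open>y \<noteq> 0\<close> by (simp add: d_def)
    ultimately show False using pos[of "d / (norm y)\<^sup>2"] by linarith
  qed
  then show thesis by (rule that)
qed

text \<open>The bound \<open>B\<close> makes the functionals \<open>inner (s n)\<close>
  equi-Lipschitz, so the Cauchy property passes to limit points by a three-epsilon argument. This
  extends convergence from a dense set to its closure.\<close>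

lemma closed_convergent_inner:
  fixes s :: "nat \<Rightarrow> 'h::real_inner"
  assumes B: "\<And>n. norm (s n) \<le> B"
  shows "closed {y. convergent (\<lambda>n. inner (s n) y)}" (is "closed ?S")
proof -
  have "0 \<le> B" by (rule order_trans[OF norm_ge_zero B])
  have "y \<in> ?S" if "y \<in> closure ?S" for y
  proof -
    have "Cauchy (\<lambda>n. inner (s n) y)"
    proof (rule metric_CauchyI)
      fix e :: real assume "0 < e"
      \<comment> \<open>\<open>B + 1\<close> keeps the denominator positive when
        \<open>B = 0\<close>.\<close>
      then have "0 < e / (3 * (B + 1))" using \<open>0 \<le> B\<close> by simp
      then obtain z where z: "z \<in> ?S" "dist z y < e / (3 * (B + 1))"
        using \<open>y \<in> closure ?S\<close> unfolding closure_approachable by blast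
      have near: "\<bar>inner (s n) z - inner (s n) y\<bar> < e / 3" for n
      proof -
        have "\<bar>inner (s n) z - inner (s n) y\<bar> \<le> norm (s n) * norm (z - y)"
          unfolding inner_diff_right[symmetric] by (rule Cauchy_Schwarz_ineq2)
        also have "\<dots> \<le> (B + 1) * norm (z - y)"
          using B[of n] by (intro mult_right_mono) auto
        also have "\<dots> < e / 3"
          using z(2) \<open>0 \<le> B\<close> by (simp add: dist_norm field_simps)
        finally show ?thesis .
      qed
      have "Cauchy (\<lambda>n. inner (s n) z)" using z(1) by (intro convergent_Cauchy) simp
      from metric_CauchyD[OF this, of "e / 3"] obtain N where N: "\<And>i j. N \<le> i \<Longrightarrow> N \<le> j \<Longrightarrow> dist (inner (s i) z) (inner (s j) z) < e / 3"
        using \<open>0 < e\<close> by auto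
      have "dist (inner (s i) y) (inner (s j) y) < e" if "N \<le> i" "N \<le> j" for i j
        using N[OF that] near[of i] near[of j] unfolding dist_real_def by linarith
      then show "\<exists>N. \<forall>i\<ge>N. \<forall>j\<ge>N. dist (inner (s i) y) (inner (s j) y) < e" by blast
    qed
    then show ?thesis using Cauchy_convergent by blast
  qed
  then show ?thesis using closure_subset_eq by blast
qed

text \<open>Diagonal extraction gives convergence against a countable dense set, density extends it
  to every vector, and the Riesz representation turns the limit functional into a vector.\<close>

lemma bounded_imp_weakly_convergent_subsequence:
  fixes s :: "nat \<Rightarrow> 'h::{real_inner, polish_space}"
  assumes B: "\<And>n. norm (s n) \<le> B"
  obtains r x where "strict_mono (r :: nat \<Rightarrow> nat)" "weakly_converges (s \<circ> r) x"
proof -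
  obtain D :: "'h set" where D: "countable D" "UNIV \<subseteq> closure D"
    using separable[of UNIV] by metis
  \<comment> \<open>The diagonal extraction needs one bound valid for all \<open>d\<close>, hence
    the normalisation by \<open>sgn\<close>; multiplying by \<open>norm d\<close> undoes it
    below.\<close>
  have "norm (inner (s n) (sgn d)) \<le> B" for n d
  proof -
    have "norm (inner (s n) (sgn d)) \<le> norm (s n) * norm (sgn d)"
      using Cauchy_Schwarz_ineq2 by simp
    also have "\<dots> \<le> norm (s n) * 1" by (intro mult_left_mono) (auto simp: norm_sgn)
    finally show ?thesis using B[of n] by simp
  qed
  then obtain r where r: "strict_mono (r :: nat \<Rightarrow> nat)"
    and conv: "\<And>d. d \<in> D \<Longrightarrow> \<exists>l. (\<lambda>n. inner (s (r n)) (sgn d)) \<longlonglongrightarrow> l"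
    using function_convergent_subsequence[OF D(1), of "\<lambda>n d. inner (s n) (sgn d)" B] by metis
  have "convergent (\<lambda>n. inner (s (r n)) d)" if "d \<in> D" for d
  proof -
    obtain l where "(\<lambda>n. inner (s (r n)) (sgn d)) \<longlonglongrightarrow> l" using conv \<open>d \<in> D\<close> by blast
    then have "(\<lambda>n. norm d * inner (s (r n)) (sgn d)) \<longlonglongrightarrow> norm d * l"
      by (rule tendsto_mult_left)
    moreover have "norm d * inner (s (r n)) (sgn d) = inner (s (r n)) d" for n
      by (cases "d = 0") (simp_all add: sgn_div_norm)
    ultimately show ?thesis by (auto simp: convergent_def)
  qed
  then have "closure D \<subseteq> {y. convergent (\<lambda>n. inner (s (r n)) y)}"
    using B by (intro closure_minimal closed_convergent_inner) auto
  then have "convergent (\<lambda>n. inner (s (r n)) y)" for y using D(2) by auto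
  then obtain f where f: "(\<lambda>n. inner (s (r n)) y) \<longlonglongrightarrow> f y" for y
    unfolding convergent_def by metis
  have "bounded_linear f"
  proof (rule bounded_linear_intro[where K = B])
    fix x y and c :: real
    show "f (x + y) = f x + f y"
      using LIMSEQ_unique[OF f[of "x + y"]] tendsto_add[OF f[of x] f[of y]]
      by (simp add: inner_add_right)
    show "f (c *\<^sub>R x) = c *\<^sub>R f x"
      using LIMSEQ_unique[OF f[of "c *\<^sub>R x"]] tendsto_mult_left[OF f[of x], of c] by simp
    show "norm (f x) \<le> norm x * B"
    proof (rule LIMSEQ_le_const2[OF tendsto_norm[OF f]])
      have "norm (inner (s (r n)) x) \<le> norm x * B" for n
        using Cauchy_Schwarz_ineq2[of "s (r n)" x] mult_left_mono[OF B[of "r n"], of "norm x"]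
        by (simp add: mult.commute)
      then show "\<exists>N. \<forall>n\<ge>N. norm (inner (s (r n)) x) \<le> norm x * B" by blast
    qed
  qed
  then obtain x where "\<And>y. f y = inner x y" using riesz_representation by metis
  then have "weakly_converges (s \<circ> r) x" using f by (simp add: weakly_converges_def)
  then show thesis using that r by blast
qed

text \<open>If weak convergence to \<open>x\<close> failed, some \<open>inner (s n) y\<close> would
  stay away from \<open>inner x y\<close> along a subsequence. A further subsequence converges
  weakly by boundedness, and uniqueness makes its limit \<open>x\<close>, a contradiction.\<close>

lemma weakly_converges_unique_cluster_point:
  fixes s :: "nat \<Rightarrow> 'h::{real_inner, polish_space}"
  assumes B: "\<And>n. norm (s n) \<le> B"
    and unique: "\<And>x y. weak_seq_cluster_point s x \<Longrightarrow> weak_seq_cluster_point s y \<Longrightarrow> x = y"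
  obtains x where "weak_seq_cluster_point s x" "weakly_converges s x"
proof -
  obtain r0 x where "strict_mono (r0 :: nat \<Rightarrow> nat)" "weakly_converges (s \<circ> r0) x"
    using bounded_imp_weakly_convergent_subsequence[of s B, OF B] by blast
  then have x: "weak_seq_cluster_point s x" unfolding weak_seq_cluster_point_def by blast
  have "(\<lambda>n. inner (s n) y) \<longlonglongrightarrow> inner x y" for y
  proof (rule ccontr)
    assume "\<not> ?thesis"
    then have "\<exists>e>0. \<forall>N. \<exists>n\<ge>N. \<not> dist (inner (s n) y) (inner x y) < e"
      unfolding lim_sequentially by simp
    then obtain e where "0 < e"
      and far: "\<forall>N. \<exists>n\<ge>N. \<not> dist (inner (s n) y) (inner x y) < e"
      by blast
    define P where "P n \<longleftrightarrow> \<not> dist (inner (s n) y) (inner x y) < e" for n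
    have "infinite {n. P n}"
      using far unfolding infinite_nat_iff_unbounded_le P_def by simp
    from infinite_enumerate[OF this] obtain r
      where r: "strict_mono (r :: nat \<Rightarrow> nat)" "\<And>n. P (r n)"
      by blast
    have sr: "norm ((s \<circ> r) n) \<le> B" for n using B by simp
    obtain r' z where r': "strict_mono (r' :: nat \<Rightarrow> nat)" "weakly_converges ((s \<circ> r) \<circ> r') z"
      by (rule bounded_imp_weakly_convergent_subsequence[of "s \<circ> r" B, OF sr])
    then have "weak_seq_cluster_point s z"
      unfolding weak_seq_cluster_point_def
      using strict_mono_o[OF r(1) r'(1)] unfolding comp_assoc by blast
    then have "z = x" by (rule unique[OF _ x])
    then have "(\<lambda>n. inner (s (r (r' n))) y) \<longlonglongrightarrow> inner x y"
      using r'(2) by (simp add: weakly_converges_def)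
    then have "\<exists>n. dist (inner (s (r (r' n))) y) (inner x y) < e"
      using \<open>0 < e\<close> unfolding lim_sequentially by (meson order_refl)
    then show False using r(2) unfolding P_def by blast
  qed
  then show thesis using that x by (simp add: weakly_converges_def)
qed

lemma tendsto_inner_weak_strong:
  fixes s t :: "nat \<Rightarrow> 'h::real_inner"
  assumes B: "\<And>n. norm (s n) \<le> B" and "weakly_converges s x" and "t \<longlonglongrightarrow> y"
  shows "(\<lambda>n. inner (s n) (t n)) \<longlonglongrightarrow> inner x y"
proof -
  have "(\<lambda>n. norm (t n - y)) \<longlonglongrightarrow> 0"
    by (rule tendsto_norm_zero[OF LIM_zero[OF assms(3)]])
  then have null: "(\<lambda>n. B * norm (t n - y)) \<longlonglongrightarrow> 0"
    by (rule tendsto_mult_right_zero)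
  have "norm (inner (s n) (t n - y)) \<le> B * norm (t n - y)" for n
  proof -
    have "norm (inner (s n) (t n - y)) \<le> norm (s n) * norm (t n - y)"
      unfolding real_norm_def by (rule Cauchy_Schwarz_ineq2)
    also have "\<dots> \<le> B * norm (t n - y)" by (rule mult_right_mono[OF B norm_ge_zero])
    finally show ?thesis .
  qed
  then have "(\<lambda>n. inner (s n) (t n - y)) \<longlonglongrightarrow> 0"
    by (intro Lim_null_comparison[OF always_eventually null]) blast
  moreover have "(\<lambda>n. inner (s n) y) \<longlonglongrightarrow> inner x y"
    using assms(2) by (simp add: weakly_converges_def)
  ultimately have "(\<lambda>n. inner (s n) (t n - y) + inner (s n) y) \<longlonglongrightarrow> 0 + inner x y"
    by (rule tendsto_add)
  then show ?thesis by (simp add: inner_diff_right)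
qed

section \<open>Quasi-decreasing sequences of operators\<close>

lemma selfadjoint_ops_inner:
  "T \<in> selfadjoint_ops \<Longrightarrow> inner (blinfun_apply T x) y = inner (blinfun_apply T y) x"
  unfolding selfadjoint_ops_def by (simp add: inner_commute)

lemma selfadjoint_ops_diff_scaleR:
  assumes "S \<in> selfadjoint_ops" "T \<in> selfadjoint_ops"
  shows "a *\<^sub>R S - b *\<^sub>R T \<in> selfadjoint_ops"
  using assms unfolding selfadjoint_ops_def
  by (simp add: blinfun.bilinear_simps inner_diff_left inner_diff_right)

text \<open>Comes from expanding positivity of the form at \<open>M *\<^sub>R x - T x\<close>. It
  turns control of quadratic forms into control of vectors, hence monotone convergence of forms into
  strong convergence.\<close>

lemma norm_positive_selfadjoint_le:
  fixes T :: "'h::real_inner \<Rightarrow>\<^sub>L 'h"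
  assumes T: "T \<in> selfadjoint_ops"
    and pos: "\<And>x. 0 \<le> inner (blinfun_apply T x) x"
    and M: "\<And>x. inner (blinfun_apply T x) x \<le> M * (norm x)\<^sup>2"
  shows "(norm (blinfun_apply T x))\<^sup>2 \<le> M * inner (blinfun_apply T x) x"
proof (cases "M = 0")
  case True
  \<comment> \<open>For \<open>M = 0\<close> the expansion at \<open>M *\<^sub>R x - T x\<close>
    gives no information. Here the form vanishes identically, and its value at \<open>x + y\<close>
    isolates the cross term.\<close>
  define y where "y = blinfun_apply T x"
  have zero: "inner (blinfun_apply T z) z = 0" for z
    using pos[of z] M[of z] True by simp
  have "inner (blinfun_apply T (x + y)) (x + y) = 2 * (norm y)\<^sup>2"
    using zero[of x] zero[of y] selfadjoint_ops_inner[OF T, of y x]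
    by (simp add: blinfun.bilinear_simps inner_add power2_norm_eq_inner y_def)
  then show ?thesis using zero True by (simp add: y_def)
next
  case False
  show ?thesis
  proof (cases "x = 0")
    case True then show ?thesis by simp
  next
    case nz: False
    have "0 \<le> M * (norm x)\<^sup>2" using pos[of x] M[of x] by linarith
    \<comment> \<open>The sign of \<open>M\<close> is not assumed; the two bounds on the form at a
      nonzero \<open>x\<close> force it.\<close>
    then have "0 < M" using False nz by (simp add: zero_le_mult_iff)
    define y where "y = blinfun_apply T x"
    have "0 \<le> inner (blinfun_apply T (M *\<^sub>R x - y)) (M *\<^sub>R x - y)" by (rule pos)
    also have "\<dots> = M\<^sup>2 * inner y x - 2 * M * (norm y)\<^sup>2 + inner (blinfun_apply T y) y"
      using selfadjoint_ops_inner[OF T, of y x] unfolding power2_norm_eq_inner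
      by (simp add: blinfun.bilinear_simps inner_diff y_def power2_eq_square algebra_simps)
    also have "\<dots> \<le> M\<^sup>2 * inner y x - 2 * M * (norm y)\<^sup>2 + M * (norm y)\<^sup>2"
      using M[of y] by simp
    also have "\<dots> = M * (M * inner y x - (norm y)\<^sup>2)"
      by (simp add: power2_eq_square algebra_simps)
    finally show ?thesis using \<open>0 < M\<close> by (simp add: zero_le_mult_iff y_def)
  qed
qed

text \<open>Vigier's theorem on monotone sequences of self-adjoint operators, applied after
  rescaling. The scaling factors converge, so strong convergence and boundedness carry back to
  \<open>T\<close>.\<close>

lemma quasi_decreasing_operators_convergent:
  fixes T :: "nat \<Rightarrow> 'h::{real_inner, complete_space} \<Rightarrow>\<^sub>L 'h"
  assumes T: "\<And>k. T k \<in> selfadjoint_ops"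
    and pos: "\<And>k x. 0 \<le> inner (blinfun_apply (T k) x) x"
    and \<eta>: "\<And>k. 0 \<le> \<eta> k" "summable \<eta>"
    and decr: "\<And>k. loewner_le (T (Suc k)) ((1 + \<eta> k) *\<^sub>R T k)"
  obtains M where "\<And>k x. norm (blinfun_apply (T k) x) \<le> M * norm x"
    and "\<And>x. convergent (\<lambda>k. blinfun_apply (T k) x)"
proof -
  define a where "a k = (\<Prod>j<k. 1 + \<eta> j)" for k
  have a_ge: "1 \<le> a k" for k
    unfolding a_def using \<eta>(1) by (intro prod_ge_1) auto
  then have a_pos: "0 < a k" for k by (meson less_le_trans zero_less_one)
  have a_Suc: "a (Suc k) = (1 + \<eta> k) * a k" for k by (simp add: a_def mult.commute)
  \<comment> \<open>The inequality \<open>1 + t \<le> exp t\<close> bounds every partial product by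
    the exponential of the total sum.\<close>
  define L where "L = exp (suminf \<eta>)"
  have a_le: "a k \<le> L" for k
  proof -
    have "a k \<le> exp (sum \<eta> {..<k})" unfolding a_def using \<eta>(1) by (intro prod_le_exp_sum) auto
    also have "\<dots> \<le> L" unfolding L_def using sum_le_suminf[OF \<eta>(2)] \<eta>(1) by simp
    finally show ?thesis .
  qed
  have "incseq a"
    using a_pos \<eta>(1) by (intro incseq_SucI) (simp add: a_Suc less_imp_le distrib_right)
  then have a_conv: "convergent a"
    using a_le by (metis convergentI incseq_convergent)
  define N where "N k = (1 / a k) *\<^sub>R T k" for k
  define q where "q k x = inner (blinfun_apply (N k) x) x" for k x
  have q_nonneg: "0 \<le> q k x" for k x
    using pos a_pos by (simp add: q_def N_def blinfun.bilinear_simps less_imp_le)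
  have q_decr: "decseq (\<lambda>k. q k x)" for x
  proof (rule decseq_SucI)
    fix k
    have "inner (blinfun_apply (T (Suc k)) x) x \<le> (1 + \<eta> k) * inner (blinfun_apply (T k) x) x"
      using decr[of k] by (simp add: loewner_le_def blinfun.bilinear_simps)
    then have "inner (blinfun_apply (T (Suc k)) x) x / a (Suc k) \<le>
        (1 + \<eta> k) * inner (blinfun_apply (T k) x) x / a (Suc k)"
      using a_pos[of "Suc k"] by (intro divide_right_mono) auto
    also have "\<dots> = inner (blinfun_apply (T k) x) x / a k"
      using \<eta>(1)[of k] by (simp add: a_Suc add_nonneg_eq_0_iff)
    finally show "q (Suc k) x \<le> q k x"
      by (simp add: q_def N_def blinfun.bilinear_simps)
  qed
  define M where "M = norm (T 0)"
  have q_le: "q k x \<le> M * (norm x)\<^sup>2" for k x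
  proof -
    have "q k x \<le> q 0 x" using decseqD[OF q_decr, of 0 k x] by simp
    also have "\<dots> = inner (blinfun_apply (T 0) x) x" by (simp add: q_def N_def a_def)
    also have "\<dots> \<le> norm (blinfun_apply (T 0) x) * norm x" by (rule norm_cauchy_schwarz)
    also have "\<dots> \<le> M * norm x * norm x"
      unfolding M_def by (intro mult_right_mono norm_blinfun) auto
    finally show ?thesis by (simp add: power2_eq_square mult.assoc)
  qed
  have M0: "0 \<le> M" by (simp add: M_def)
  have N_sa: "N k \<in> selfadjoint_ops" for k
    \<comment> \<open>The coefficient \<open>0\<close> on the second operator reduces the difference
      to a scalar multiple.\<close>
    using selfadjoint_ops_diff_scaleR[OF T T, of "1 / a k" k 0] by (simp add: N_def)
  have N_conv: "convergent (\<lambda>k. blinfun_apply (N k) x)" for x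
  proof (rule Cauchy_convergent, rule metric_CauchyI)
    fix e :: real assume "0 < e"
    \<comment> \<open>For \<open>i \<le> j\<close> the difference \<open>N i - N j\<close> is
      positive with form at most \<open>q i\<close>, so the norm estimate applies with the same
      \<open>M\<close> for all pairs.\<close>
    have ineq: "(norm (blinfun_apply (N i) x - blinfun_apply (N j) x))\<^sup>2 \<le> M * (q i x - q j x)"
      if "i \<le> j" for i j
    proof -
      have eq: "inner (blinfun_apply (N i - N j) y) y = q i y - q j y" for y
        by (simp add: q_def blinfun.bilinear_simps inner_diff_left)
      have "N i - N j \<in> selfadjoint_ops"
        using selfadjoint_ops_diff_scaleR[OF N_sa N_sa, of 1 i 1 j] by simp
      moreover have "0 \<le> inner (blinfun_apply (N i - N j) y) y" for y
        unfolding eq using decseqD[OF q_decr that] by simp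
      moreover have "inner (blinfun_apply (N i - N j) y) y \<le> M * (norm y)\<^sup>2" for y
        unfolding eq using q_le[of i y] q_nonneg[of j y] by linarith
      ultimately have "(norm (blinfun_apply (N i - N j) x))\<^sup>2 \<le> M * (q i x - q j x)"
        using norm_positive_selfadjoint_le[of "N i - N j" M x] eq by simp
      then show ?thesis by (simp add: blinfun.bilinear_simps)
    qed
    have "convergent (\<lambda>k. q k x)"
      using decseq_convergent[OF q_decr, of 0 x] q_nonneg by (metis convergentI)
    then have "Cauchy (\<lambda>k. q k x)" by (rule convergent_Cauchy)
    then obtain n0 where n0: "\<And>i j. n0 \<le> i \<Longrightarrow> n0 \<le> j \<Longrightarrow> dist (q i x) (q j x) < e\<^sup>2 / (M + 1)"
      using metric_CauchyD[of _ "e\<^sup>2 / (M + 1)"] \<open>0 < e\<close> M0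
      by (metis add_nonneg_pos divide_pos_pos zero_less_one zero_less_power)
    have near: "dist (blinfun_apply (N i) x) (blinfun_apply (N j) x) < e"
      if "n0 \<le> i" "i \<le> j" for i j
    proof -
      have "q i x - q j x < e\<^sup>2 / (M + 1)"
        using n0[of i j] that by (simp add: dist_real_def)
      then have "(M + 1) * (q i x - q j x) < e\<^sup>2"
        using M0 by (simp add: field_simps)
      moreover have "M * (q i x - q j x) \<le> (M + 1) * (q i x - q j x)"
        using decseqD[OF q_decr that(2)] by (intro mult_right_mono) auto
      ultimately have "(dist (blinfun_apply (N i) x) (blinfun_apply (N j) x))\<^sup>2 < e\<^sup>2"
        using ineq[OF that(2)] unfolding dist_norm by linarith
      then show ?thesis using \<open>0 < e\<close> by (simp add: power2_less_imp_less)
    qed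
    have "dist (blinfun_apply (N i) x) (blinfun_apply (N j) x) < e"
      if "n0 \<le> i" "n0 \<le> j" for i j
      using near[of i j] near[of j i] that by (cases "i \<le> j") (auto simp: dist_commute)
    then show "\<exists>n0. \<forall>i\<ge>n0. \<forall>j\<ge>n0. dist (blinfun_apply (N i) x) (blinfun_apply (N j) x) < e"
      by blast
  qed
  have TN: "blinfun_apply (T k) x = a k *\<^sub>R blinfun_apply (N k) x" for k x
    using a_pos[of k] by (simp add: N_def blinfun.bilinear_simps)
  have "convergent (\<lambda>k. blinfun_apply (T k) x)" for x
    using a_conv N_conv[of x] tendsto_scaleR unfolding TN convergent_def by metis
  moreover have "norm (blinfun_apply (T k) x) \<le> (L * M) * norm x" for k x
  proof -
    have "(norm (blinfun_apply (N k) x))\<^sup>2 \<le> M * q k x"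
      unfolding q_def
      by (rule norm_positive_selfadjoint_le[OF N_sa]) (use q_nonneg q_le in \<open>auto simp: q_def\<close>)
    also have "\<dots> \<le> (M * norm x)\<^sup>2"
      using mult_left_mono[OF q_le M0, of k x] by (simp add: power2_eq_square mult_ac)
    finally have "norm (blinfun_apply (N k) x) \<le> M * norm x"
      by (rule power2_le_imp_le) (use M0 in simp)
    then have "a k * norm (blinfun_apply (N k) x) \<le> L * (M * norm x)"
      using a_le[of k] by (intro mult_mono) (auto simp: L_def)
    then show ?thesis using a_pos[of k] by (simp add: TN mult.assoc)
  qed
  ultimately show thesis using that by blast
qed

section \<open>Opial's argument with a variable metric\<close>

text \<open>The deterministic core, to be applied to one sample path at a time. Keeping
  \<open>D\<close> apart from \<open>C\<close> lets a countable set carry the stability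
  hypothesis.\<close>

lemma weakly_converges_variable_metric:
  fixes T :: "nat \<Rightarrow> 'h::{real_inner, polish_space} \<Rightarrow>\<^sub>L 'h"
  assumes T: "\<And>k. T k \<in> selfadjoint_ops_ge \<alpha>" and "0 < \<alpha>"
    and \<eta>: "\<And>k. 0 \<le> \<eta> k" "summable \<eta>"
    and decr: "\<And>k. loewner_le (T (Suc k)) ((1 + \<eta> k) *\<^sub>R T k)"
    and D: "D \<noteq> {}" "C \<subseteq> closure D"
    and stable: "\<And>z. z \<in> D \<Longrightarrow> convergent (\<lambda>k. op_norm (T k) (s k - z))"
    and cluster: "\<And>x. weak_seq_cluster_point s x \<Longrightarrow> x \<in> C"
  obtains x where "x \<in> C" "weakly_converges s x"
proof -
  have T_sa: "T k \<in> selfadjoint_ops" for k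
    using T by (simp add: selfadjoint_ops_ge_def)
  have coercive: "\<alpha> * (norm x)\<^sup>2 \<le> inner (blinfun_apply (T k) x) x" for k x
    using T[of k]
    by (simp add: selfadjoint_ops_ge_def loewner_le_def blinfun.bilinear_simps power2_norm_eq_inner)
  have pos: "0 \<le> inner (blinfun_apply (T k) x) x" for k x
    using coercive[of x k] \<open>0 < \<alpha>\<close> by (meson order_trans zero_le_mult_iff zero_le_power2 less_imp_le)
  obtain M where M: "\<And>k x. norm (blinfun_apply (T k) x) \<le> M * norm x"
    and T_conv: "\<And>x. convergent (\<lambda>k. blinfun_apply (T k) x)"
    using quasi_decreasing_operators_convergent[OF T_sa pos \<eta> decr] by metis
  have form_conv: "convergent (\<lambda>k. inner (blinfun_apply (T k) (s k - z)) (s k - z))"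
    if "z \<in> D" for z
  proof -
    have "convergent (\<lambda>k. op_norm (T k) (s k - z) * op_norm (T k) (s k - z))"
      using stable[OF that] by (intro convergent_mult)
    then show ?thesis using pos by (simp add: op_norm_def)
  qed
  obtain z0 where z0: "z0 \<in> D" using D by blast
  \<comment> \<open>Coercivity bounds the distance to \<open>z0\<close> by the quadratic form, which
    is bounded because it converges.\<close>
  obtain B where B: "norm (s k) \<le> B" for k
  proof -
    obtain K where K: "norm (inner (blinfun_apply (T k) (s k - z0)) (s k - z0)) \<le> K" for k
      using convergent_imp_Bseq[OF form_conv[OF z0]] unfolding Bseq_def by blast
    have "norm (s k) \<le> norm z0 + sqrt (K / \<alpha>)" for k
    proof -
      have "\<alpha> * (norm (s k - z0))\<^sup>2 \<le> K"
        using coercive[of "s k - z0" k] K[of k] by simp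
      then have "(norm (s k - z0))\<^sup>2 \<le> K / \<alpha>" using \<open>0 < \<alpha>\<close> by (simp add: field_simps)
      then have "norm (s k - z0) \<le> sqrt (K / \<alpha>)" by (rule real_le_rsqrt)
      then show ?thesis using norm_triangle_sub[of "s k" z0] by linarith
    qed
    then show thesis by (rule that)
  qed
  have Ts_bound: "norm (blinfun_apply (T k) (s k)) \<le> \<bar>M\<bar> * B" for k
  proof -
    have "norm (blinfun_apply (T k) (s k)) \<le> \<bar>M\<bar> * norm (s k)"
      using M[of k "s k"] by (meson abs_ge_self mult_right_mono norm_ge_zero order_trans)
    also have "\<dots> \<le> \<bar>M\<bar> * B" by (intro mult_left_mono B) simp
    finally show ?thesis .
  qed
  have pair_conv: "convergent (\<lambda>k. inner (blinfun_apply (T k) (s k)) (z - z0))" if "z \<in> D" for z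
  proof -
    have c: "convergent (\<lambda>k. inner (blinfun_apply (T k) z) z)" for z
      using T_conv[of z] tendsto_inner[OF _ tendsto_const] unfolding convergent_def by metis
    \<comment> \<open>In the difference of the two forms the term
      \<open>inner (T k (s k)) (s k)\<close>, whose convergence is unknown, cancels.\<close>
    have "(\<lambda>k. inner (blinfun_apply (T k) (s k)) (z - z0)) =
        (\<lambda>k. (inner (blinfun_apply (T k) (s k - z0)) (s k - z0)
          - inner (blinfun_apply (T k) (s k - z)) (s k - z)
          + (inner (blinfun_apply (T k) z) z - inner (blinfun_apply (T k) z0) z0)) * (1 / 2))"
      (is "_ = ?R")
    proof
      fix k
      show "inner (blinfun_apply (T k) (s k)) (z - z0) = ?R k"
        using selfadjoint_ops_inner[OF T_sa, of k z "s k"]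
          selfadjoint_ops_inner[OF T_sa, of k z0 "s k"]
        by (simp add: blinfun.bilinear_simps inner_diff)
    qed
    moreover have "convergent ?R"
      by (intro convergent_mult convergent_add convergent_diff convergent_const form_conv z0 that c)
    ultimately show ?thesis by simp
  qed
  have pair_conv': "convergent (\<lambda>k. inner (blinfun_apply (T k) (s k)) (z - z0))" if "z \<in> C" for z
  proof -
    let ?S = "{y. convergent (\<lambda>k. inner (blinfun_apply (T k) (s k)) y)}"
    have "closed ((\<lambda>z. z - z0) -` ?S)"
      by (intro closed_vimage closed_convergent_inner[OF Ts_bound] continuous_intros)
    then have "closure D \<subseteq> (\<lambda>z. z - z0) -` ?S"
      using pair_conv by (intro closure_minimal) auto
    then show ?thesis using that D(2) by auto
  qed
  have "x = y" if xy: "weak_seq_cluster_point s x" "weak_seq_cluster_point s y" for x y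
  proof -
    define v where "v = x - y"
    have "convergent (\<lambda>k. inner (blinfun_apply (T k) (s k)) (x - z0)
        - inner (blinfun_apply (T k) (s k)) (y - z0))"
      by (intro convergent_diff pair_conv' cluster xy)
    \<comment> \<open>The base point \<open>z0\<close> cancels, and self-adjointness moves
      \<open>T k\<close> onto the fixed vector \<open>v\<close>.\<close>
    then have "convergent (\<lambda>k. inner (s k) (blinfun_apply (T k) v))"
      using T_sa by (simp add: v_def inner_diff_right selfadjoint_ops_def blinfun.bilinear_simps)
    then obtain l where l: "(\<lambda>k. inner (s k) (blinfun_apply (T k) v)) \<longlonglongrightarrow> l"
      by (auto simp: convergent_def)
    obtain w where w: "(\<lambda>k. blinfun_apply (T k) v) \<longlonglongrightarrow> w"
      using T_conv[of v] by (auto simp: convergent_def)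
    have limit: "inner p w = l" if "weak_seq_cluster_point s p" for p
    proof -
      obtain r where r: "strict_mono (r :: nat \<Rightarrow> nat)" "weakly_converges (s \<circ> r) p"
        using \<open>weak_seq_cluster_point s p\<close> by (auto simp: weak_seq_cluster_point_def)
      have "(\<lambda>n. inner ((s \<circ> r) n) (((\<lambda>k. blinfun_apply (T k) v) \<circ> r) n)) \<longlonglongrightarrow> inner p w"
        using B by (intro tendsto_inner_weak_strong[OF _ r(2) LIMSEQ_subseq_LIMSEQ[OF w r(1)]]) simp
      moreover have "((\<lambda>k. inner (s k) (blinfun_apply (T k) v)) \<circ> r) \<longlonglongrightarrow> l"
        by (rule LIMSEQ_subseq_LIMSEQ[OF l r(1)])
      ultimately show ?thesis by (simp add: o_def LIMSEQ_unique)
    qed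
    \<comment> \<open>Coercivity at \<open>v\<close> survives the limit, and
      \<open>inner w v\<close> is the difference of the two equal values \<open>inner x w\<close>
      and \<open>inner y w\<close>.\<close>
    have "\<alpha> * (norm v)\<^sup>2 \<le> inner w v"
      by (rule LIMSEQ_le_const[OF tendsto_inner[OF w tendsto_const]]) (use coercive in blast)
    also have "\<dots> = 0"
      using limit[OF xy(1)] limit[OF xy(2)] by (simp add: v_def inner_diff inner_commute)
    finally show "x = y"
      using \<open>0 < \<alpha>\<close> by (simp add: v_def mult_le_0_iff)
  qed
  then obtain x where "weak_seq_cluster_point s x" "weakly_converges s x"
    using weakly_converges_unique_cluster_point[of s B] B by metis
  then show thesis using that cluster by blast
qed

section \<open>Measurability of the weak limit\<close>

text \<open>The separable case of Pettis' measurability theorem: membership in a closed ball is a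
  countable family of scalar inequalities, and every open set is a countable union of closed
  balls.\<close>

lemma borel_measurable_inner_imp:
  fixes X :: "'a \<Rightarrow> 'h::{real_inner, second_countable_topology}"
  assumes X: "\<And>y. (\<lambda>\<omega>. inner (X \<omega>) y) \<in> borel_measurable P"
  shows "X \<in> borel_measurable P"
proof -
  obtain D :: "'h set" where D: "countable D" "UNIV \<subseteq> closure D"
    using separable[of UNIV] by metis
  have dense: "\<exists>d\<in>D. dist d y < e" if "0 < e" for y e
    using D(2) that closure_approachable by blast
  have ball_iff: "norm z \<le> r \<longleftrightarrow> (\<forall>d\<in>D. inner z d \<le> r * norm d)" if "0 \<le> r" for z :: 'h and r
  proof
    assume "norm z \<le> r"
    then show "\<forall>d\<in>D. inner z d \<le> r * norm d"
      by (meson mult_right_mono norm_cauchy_schwarz norm_ge_zero order_trans)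
  next
    assume le: "\<forall>d\<in>D. inner z d \<le> r * norm d"
    \<comment> \<open>Closedness extends the inequality from \<open>D\<close> to all
      \<open>y\<close>; the choice \<open>y = z\<close> then bounds the norm.\<close>
    have "closed {y. inner z y \<le> r * norm y}"
      by (intro closed_Collect_le continuous_intros)
    then have "closure D \<subseteq> {y. inner z y \<le> r * norm y}"
      using le by (intro closure_minimal) auto
    then have "inner z z \<le> r * norm z" using D(2) by auto
    then show "norm z \<le> r"
      using that by (cases "z = 0") (simp_all add: power2_norm_eq_inner[symmetric] power2_eq_square)
  qed
  have cball: "X -` cball c r \<inter> space P \<in> sets P" if "0 \<le> r" for c r
  proof -
    have "X -` cball c r \<inter> space P =
        {\<omega> \<in> space P. \<forall>d\<in>D. inner (X \<omega>) d - inner c d \<le> r * norm d}"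
      using ball_iff[OF that] by (auto simp: dist_norm norm_minus_commute[of c] inner_diff_left)
    also have "\<dots> \<in> sets P"
      using D(1) X by measurable
    finally show ?thesis .
  qed
  show ?thesis
  proof (rule borel_measurableI)
    fix S :: "'h set" assume "open S"
    define I where "I = {(d, n). d \<in> D \<and> cball d (1 / real (Suc n)) \<subseteq> S}"
    have "countable I"
      by (rule countable_subset[of _ "D \<times> UNIV"]) (use D(1) in \<open>auto simp: I_def\<close>)
    have "S = (\<Union>(d, n)\<in>I. cball d (1 / real (Suc n)))"
    proof (intro equalityI subsetI)
      fix y assume "y \<in> S"
      then obtain e where e: "0 < e" "ball y e \<subseteq> S"
        using \<open>open S\<close> openE by blast
      \<comment> \<open>A radius below \<open>e / 2\<close> keeps a ball of that radius inside
        \<open>ball y e\<close> when its centre is within the radius of \<open>y\<close>.\<close>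
      then obtain n where n: "1 / real (Suc n) < e / 2"
        by (metis half_gt_zero inverse_eq_divide reals_Archimedean)
      obtain d where d: "d \<in> D" "dist d y < 1 / real (Suc n)"
        using dense[of "1 / real (Suc n)" y] by auto
      have "cball d (1 / real (Suc n)) \<subseteq> ball y e"
      proof
        fix w assume "w \<in> cball d (1 / real (Suc n))"
        then show "w \<in> ball y e"
          using d(2) n dist_triangle[of y w d] by (simp add: dist_commute)
      qed
      then have "(d, n) \<in> I" using d e by (auto simp: I_def)
      then show "y \<in> (\<Union>(d, n)\<in>I. cball d (1 / real (Suc n)))"
        using d(2) by (auto intro!: bexI[of _ "(d, n)"])
    qed (auto simp: I_def)
    then have "X -` S \<inter> space P = (\<Union>(d, n)\<in>I. X -` cball d (1 / real (Suc n)) \<inter> space P)"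
      by auto
    also have "\<dots> \<in> sets P"
      using \<open>countable I\<close> cball by (intro sets.countable_UN') auto
    finally show "X -` S \<inter> space P \<in> sets P" .
  qed
qed

text \<open>Each scalar function \<open>inner (X \<omega>) y\<close> is a pointwise limit of
  measurable ones; the constant \<open>c\<close> off \<open>E\<close> makes this limit exist on the
  whole space.\<close>

lemma borel_measurable_weak_limit:
  fixes u :: "nat \<Rightarrow> 'a \<Rightarrow> 'h::{real_inner, second_countable_topology}"
  assumes u: "\<And>k. u k \<in> borel_measurable P" and "E \<in> sets P"
    and lim: "\<And>\<omega>. \<omega> \<in> E \<Longrightarrow> weakly_converges (\<lambda>k. u k \<omega>) (X \<omega>)"
    and const: "\<And>\<omega>. \<omega> \<in> space P - E \<Longrightarrow> X \<omega> = c"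
  shows "X \<in> borel_measurable P"
proof (rule borel_measurable_inner_imp)
  fix y
  show "(\<lambda>\<omega>. inner (X \<omega>) y) \<in> borel_measurable P"
  proof (rule borel_measurable_LIMSEQ_metric)
    show "(\<lambda>\<omega>. if \<omega> \<in> E then inner (u k \<omega>) y else inner c y) \<in> borel_measurable P" for k
      using u \<open>E \<in> sets P\<close> by measurable
    show "(\<lambda>k. if \<omega> \<in> E then inner (u k \<omega>) y else inner c y) \<longlonglongrightarrow> inner (X \<omega>) y"
      if "\<omega> \<in> space P" for \<omega>
      using lim[of \<omega>] const[of \<omega>] that by (cases "\<omega> \<in> E") (auto simp: weakly_converges_def)
  qed
qed

section \<open>From sample paths to an almost sure statement\<close>

theorem theorem2p5:
  fixes P :: "'a measure"
    and C :: "'h::{real_inner, polish_space} set"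
    and Q :: "nat \<Rightarrow> 'a \<Rightarrow> ('h \<Rightarrow>\<^sub>L 'h)"
    and u :: "nat \<Rightarrow> 'a \<Rightarrow> 'h"
    and \<alpha> :: real
  assumes "prob_space P"
    and "closed C" and "C \<noteq> {}"
    and "\<And>k. random_operator P (Q k)"
    and "\<And>k. u k \<in> borel_measurable P"
    and "0 < \<alpha>"
    and "\<And>k \<omega>. \<omega> \<in> space P \<Longrightarrow> Q k \<omega> \<in> selfadjoint_ops_ge \<alpha>"
    and "quasi_decreasing P Q"
    and "stable_wrt P C Q u"
    and "\<exists>A\<in>sets P. measure P A = 1 \<and>
           (\<forall>\<omega>\<in>A. \<forall>x. weak_seq_cluster_point (\<lambda>k. u k \<omega>) x \<longrightarrow> x \<in> C)"
  shows "\<exists>X. X \<in> borel_measurable P \<and> (\<forall>\<omega>\<in>space P. X \<omega> \<in> C) \<and>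
           (AE \<omega> in P. weakly_converges (\<lambda>k. u k \<omega>) (X \<omega>))"
proof -
  interpret prob_space P by fact
  obtain D where D: "countable D" "D \<subseteq> C" "C \<subseteq> closure D"
    using separable[of C] by metis
  then have "D \<noteq> {}" using \<open>C \<noteq> {}\<close> by auto
  obtain \<eta> :: "nat \<Rightarrow> real" where \<eta>: "\<And>k. 0 \<le> \<eta> k" "summable \<eta>"
    and decr: "AE \<omega> in P. \<forall>k. loewner_le (Q (Suc k) \<omega>) ((1 + \<eta> k) *\<^sub>R Q k \<omega>)"
    using assms(8) by (auto simp: quasi_decreasing_def)
  have stable: "AE \<omega> in P. \<forall>z\<in>D. convergent (\<lambda>k. op_norm (Q k \<omega>) (u k \<omega> - z))"
    using assms(9) D by (subst AE_ball_countable) (auto simp: stable_wrt_def)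
  obtain A where A: "A \<in> sets P" "measure P A = 1"
    and cluster: "\<And>\<omega> x. \<omega> \<in> A \<Longrightarrow> weak_seq_cluster_point (\<lambda>k. u k \<omega>) x \<Longrightarrow> x \<in> C"
    using assms(10) by blast
  have "AE \<omega> in P. \<omega> \<in> A" using A by (simp add: prob_eq_1)
  with decr stable have "AE \<omega> in P. \<exists>x\<in>C. weakly_converges (\<lambda>k. u k \<omega>) x"
  proof (eventually_elim)
    case (elim \<omega>)
    then have "\<omega> \<in> space P" using A(1) sets.sets_into_space by blast
    then obtain x where "x \<in> C" "weakly_converges (\<lambda>k. u k \<omega>) x"
      using weakly_converges_variable_metric[of "\<lambda>k. Q k \<omega>" \<alpha> \<eta> D C "\<lambda>k. u k \<omega>",
          OF assms(7) \<open>0 < \<alpha>\<close> \<eta> _ \<open>D \<noteq> {}\<close> D(3) _ cluster[of \<omega>]]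
        elim by blast
    then show ?case by blast
  qed
  \<comment> \<open>The set of paths with a weak limit in \<open>C\<close> is not known to be
    measurable, so the complement of a measurable null set replaces it.\<close>
  then obtain N where N: "N \<in> null_sets P"
    "{\<omega> \<in> space P. \<not> (\<exists>x\<in>C. weakly_converges (\<lambda>k. u k \<omega>) x)} \<subseteq> N"
    by (auto simp: eventually_ae_filter)
  define E where "E = space P - N"
  have E: "E \<in> sets P" using N(1) by (auto simp: E_def)
  have "\<forall>\<omega>\<in>E. \<exists>x\<in>C. weakly_converges (\<lambda>k. u k \<omega>) x" using N(2) by (auto simp: E_def)
  \<comment> \<open>\<open>Y\<close> comes from pointwise choice and carries no measurability; that
    is recovered afterwards from weak convergence.\<close>
  then obtain Y where Y: "\<And>\<omega>. \<omega> \<in> E \<Longrightarrow> Y \<omega> \<in> C \<and> weakly_converges (\<lambda>k. u k \<omega>) (Y \<omega>)"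
    by metis
  \<comment> \<open>A default value taken in \<open>C\<close> keeps \<open>X\<close> in
    \<open>C\<close> on the exceptional null set as well.\<close>
  obtain c where "c \<in> C" using \<open>C \<noteq> {}\<close> by blast
  define X where "X \<omega> = (if \<omega> \<in> E then Y \<omega> else c)" for \<omega>
  have "X \<in> borel_measurable P"
    by (rule borel_measurable_weak_limit[of u, OF assms(5) E, where c = c]) (use Y in \<open>auto simp: X_def\<close>)
  moreover have "\<forall>\<omega>\<in>space P. X \<omega> \<in> C" using Y \<open>c \<in> C\<close> by (simp add: X_def)
  moreover have "AE \<omega> in P. weakly_converges (\<lambda>k. u k \<omega>) (X \<omega>)"
    using AE_not_in[OF N(1)] AE_space by eventually_elim (use Y in \<open>simp add: X_def E_def\<close>)
  ultimately show ?thesis by blast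
qed

end
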